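(* Assume $X\subseteq\mathbf R^m$ and $Y=(a,b)\subset\mathbf R$ are open and connected, and that $s\in C^2(X\times Y)$ is non-degenerate, meaning $D_xs_y$ is nowhere vanishing on $X\times Y$ (where $s_y=\partial s/\partial y$). Then $s$ takes pseudo-index form if and only if $(s,\mu,\nu)$ is nested for every choice of absolutely continuous probability measures $\mu$ on $X$ and $\nu$ on $Y$.
   Context: Pseudo-index form: there exist $C^1$ functions $\alpha$ and $I$ on $X$ and a $C^1$ function $\sigma$ on $I(X)\times Y\subset\mathbf R^2$ such that $s(x,y)=\alpha(x)+\sigma(I(x),y)$ for all $(x,y)\in X\times Y$. $C^2(X\times Y)$ is normed by sup norms of derivatives up to order two (so these are bounded). Notation: $X_\le(y,k)=\{x\in X: s_y(x,y)\le k\}$, $X_<(y,k)=\{x\in X: s_y(x,y)<k\}$. For $y\in Y$, $[k^-(y),k^+(y)]$ is the maximal interval of $k$ such that $\mu[X_\le(y,k)]=\nu[(-\infty,y)]$ (endpoints may be infinite if $\nu[(-\infty,y)]\in\{0,1\}$, with $X_\le(y,+\infty)=X_<(y,+\infty)=X$ and $X_\le(y,-\infty)=X_<(y,-\infty)=\emptyset$). Nested: $(s,\mu,\nu)$ is nested if both maps $y\in Y\mapsto X_\le(y,k^\pm(y))$ are non-decreasing with respect to inclusion, and $X_\le(y,k^+(y))\subseteq X_<(y',k^-(y'))$ whenever $y<y'$ in $Y$ satisfy $\nu[(y,y')]>0$. *)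

theory Defs
  imports "HOL-Probability.Probability"
begin

text \<open>
  Derivatives are taken within \<open>S\<close>, so the definition also makes sense when \<open>S\<close> is not open,
  as may happen a priori for the domain \<open>I ` X \<times> Y\<close> of \<open>\<sigma>\<close> below.
\<close>

definition C1_on :: "('a::real_normed_vector \<Rightarrow> 'b::real_normed_vector) \<Rightarrow> 'a set \<Rightarrow> bool" where
  "C1_on f S \<longleftrightarrow>
     (\<exists>f' :: 'a \<Rightarrow> 'a \<Rightarrow>\<^sub>L 'b.
        (\<forall>x\<in>S. (f has_derivative blinfun_apply (f' x)) (at x within S)) \<and>
        continuous_on S f')"

text \<open>
  The space \<open>C\<^sup>2(S)\<close> normed by the sup norms of the derivatives up to order two: its members
  are bounded together with their first and second derivatives.
\<close>

definition C2_bounded_on :: "('a::real_normed_vector \<Rightarrow> 'b::real_normed_vector) \<Rightarrow> 'a set \<Rightarrow> bool" where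
  "C2_bounded_on f S \<longleftrightarrow>
     (\<exists>(f' :: 'a \<Rightarrow> 'a \<Rightarrow>\<^sub>L 'b) (f'' :: 'a \<Rightarrow> 'a \<Rightarrow>\<^sub>L 'a \<Rightarrow>\<^sub>L 'b).
        (\<forall>x\<in>S. (f has_derivative blinfun_apply (f' x)) (at x within S)) \<and>
        (\<forall>x\<in>S. (f' has_derivative blinfun_apply (f'' x)) (at x within S)) \<and>
        continuous_on S f'' \<and>
        bounded (f ` S) \<and> bounded (f' ` S) \<and> bounded (f'' ` S))"

definition s_y :: "('a \<times> real \<Rightarrow> real) \<Rightarrow> 'a \<Rightarrow> real \<Rightarrow> real" where
  "s_y s x y = deriv (\<lambda>t. s (x, t)) y"

definition nondegenerate :: "('a::real_normed_vector) set \<Rightarrow> real set \<Rightarrow> ('a \<times> real \<Rightarrow> real) \<Rightarrow> bool" where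
  "nondegenerate X Y s \<longleftrightarrow>
     (\<forall>x\<in>X. \<forall>y\<in>Y. frechet_derivative (\<lambda>x'. s_y s x' y) (at x) \<noteq> (\<lambda>v. 0))"

definition pseudo_index_form ::
    "('a::real_normed_vector) set \<Rightarrow> real set \<Rightarrow> ('a \<times> real \<Rightarrow> real) \<Rightarrow> bool" where
  "pseudo_index_form X Y s \<longleftrightarrow>
     (\<exists>(\<alpha> :: 'a \<Rightarrow> real) (I :: 'a \<Rightarrow> real) (\<sigma> :: real \<times> real \<Rightarrow> real).
        C1_on \<alpha> X \<and> C1_on I X \<and> C1_on \<sigma> (I ` X \<times> Y) \<and>
        (\<forall>x\<in>X. \<forall>y\<in>Y. s (x, y) = \<alpha> x + \<sigma> (I x, y)))"

text \<open>
  Levels \<open>k\<close> are extended reals; the conventions for \<open>k = \<plusminus>\<infinity>\<close> (all of \<open>X\<close>, resp. the empty set)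
  follow from \<open>s_y\<close> being real-valued.
\<close>

definition X_le :: "'a set \<Rightarrow> ('a \<times> real \<Rightarrow> real) \<Rightarrow> real \<Rightarrow> ereal \<Rightarrow> 'a set" where
  "X_le X s y k = {x \<in> X. ereal (s_y s x y) \<le> k}"

definition X_less :: "'a set \<Rightarrow> ('a \<times> real \<Rightarrow> real) \<Rightarrow> real \<Rightarrow> ereal \<Rightarrow> 'a set" where
  "X_less X s y k = {x \<in> X. ereal (s_y s x y) < k}"

text \<open>
  Measures on \<open>X\<close> and \<open>Y\<close> live on the Borel sets of these subspaces, whence the intersection
  with \<open>Y\<close> in \<open>\<nu>[(-\<infinity>, y)]\<close>. Since \<open>k \<mapsto> \<mu>[X\<^sub>\<le>(y, k)]\<close> is monotone, the solution set below
  is an interval, and \<open>k\<^sup>-(y)\<close>, \<open>k\<^sup>+(y)\<close> are its endpoints.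
\<close>

definition levels ::
    "'a set \<Rightarrow> real set \<Rightarrow> ('a \<times> real \<Rightarrow> real) \<Rightarrow> 'a measure \<Rightarrow> real measure \<Rightarrow> real \<Rightarrow> ereal set" where
  "levels X Y s \<mu> \<nu> y = {k. measure \<mu> (X_le X s y k) = measure \<nu> (Y \<inter> {..<y})}"

definition k_minus ::
    "'a set \<Rightarrow> real set \<Rightarrow> ('a \<times> real \<Rightarrow> real) \<Rightarrow> 'a measure \<Rightarrow> real measure \<Rightarrow> real \<Rightarrow> ereal" where
  "k_minus X Y s \<mu> \<nu> y = Inf (levels X Y s \<mu> \<nu> y)"

definition k_plus ::
    "'a set \<Rightarrow> real set \<Rightarrow> ('a \<times> real \<Rightarrow> real) \<Rightarrow> 'a measure \<Rightarrow> real measure \<Rightarrow> real \<Rightarrow> ereal" where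
  "k_plus X Y s \<mu> \<nu> y = Sup (levels X Y s \<mu> \<nu> y)"

definition nested ::
    "'a set \<Rightarrow> real set \<Rightarrow> ('a \<times> real \<Rightarrow> real) \<Rightarrow> 'a measure \<Rightarrow> real measure \<Rightarrow> bool" where
  "nested X Y s \<mu> \<nu> \<longleftrightarrow>
     mono_on Y (\<lambda>y. X_le X s y (k_minus X Y s \<mu> \<nu> y)) \<and>
     mono_on Y (\<lambda>y. X_le X s y (k_plus X Y s \<mu> \<nu> y)) \<and>
     (\<forall>y\<in>Y. \<forall>y'\<in>Y. y < y' \<longrightarrow> measure \<nu> {y<..<y'} > 0 \<longrightarrow>
        X_le X s y (k_plus X Y s \<mu> \<nu> y) \<subseteq> X_less X s y' (k_minus X Y s \<mu> \<nu> y'))"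

definition ac_prob_on :: "('a::euclidean_space) set \<Rightarrow> 'a measure \<Rightarrow> bool" where
  "ac_prob_on S M \<longleftrightarrow>
     prob_space M \<and> sets M = sets (restrict_space borel S) \<and>
     absolutely_continuous (restrict_space lborel S) M"

end

theory Submission imports Defs begin

text \<open>
  Both conditions are equivalent to the statement that the functions \<open>s\<^sub>y(\<cdot>, y)\<close>, for \<open>y \<in> Y\<close>, all
  order the points of \<open>X\<close> in the same way.

  In pseudo-index form \<open>s\<^sub>y(x, y) = \<sigma>\<^sub>y(I(x), y)\<close>, and \<open>\<sigma>\<^sub>y(\<cdot>, y)\<close> is injective on the interval
  \<open>I(X)\<close>, because an interior extremum would be a local extremum of \<open>s\<^sub>y(\<cdot>, y)\<close>, which
  non-degeneracy excludes. Hence \<open>s\<^sub>y(x, y) - s\<^sub>y(z, y)\<close> either vanishes for all \<open>y\<close> or for none, and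
  its sign does not depend on \<open>y\<close>. Conversely, if the orders agree, take \<open>I(x) = s\<^sub>y(x, y\<^sub>0)\<close> and
  \<open>\<alpha>(x) = s(x, y\<^sub>0)\<close>; the increment \<open>s(x, y) - s(x, y\<^sub>0)\<close> depends on \<open>x\<close> only through \<open>I(x)\<close>, and it is
  \<open>C\<^sup>1\<close> in \<open>(I(x), y)\<close> because \<open>I\<close> has local \<open>C\<^sup>1\<close> sections.

  If the orders agree, all sublevel sets form a single chain under inclusion, and nestedness is a
  comparison of their masses; the levels exist because level sets are null. If the orders at \<open>y < y'\<close>
  disagree on two points, put half of the mass of \<open>\<mu>\<close> near each of them and half of the mass of \<open>\<nu>\<close>
  on either side of \<open>[y, y']\<close>: the median sublevel sets at \<open>y\<close> and \<open>y'\<close> contain different halves.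
\<close>

section \<open>Calculus\<close>

lemma C1_onI:
  assumes "\<And>x. x \<in> S \<Longrightarrow> (f has_derivative blinfun_apply (f' x)) (at x within S)"
    and "continuous_on S f'"
  shows "C1_on f S"
  using assms unfolding C1_on_def by blast

lemma C1_onE:
  assumes "C1_on f S"
  obtains f' where "\<And>x. x \<in> S \<Longrightarrow> (f has_derivative blinfun_apply (f' x)) (at x within S)"
    and "continuous_on S f'"
  using assms unfolding C1_on_def by blast

lemma C1_on_cong:
  assumes "\<And>x. x \<in> S \<Longrightarrow> f x = g x"
  shows "C1_on f S \<longleftrightarrow> C1_on g S"
  unfolding C1_on_def
  by (metis assms has_derivative_transform)

lemma C1_on_imp_continuous_on: "C1_on f S \<Longrightarrow> continuous_on S f"
  unfolding C1_on_def continuous_on_eq_continuous_within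
  by (meson has_derivative_continuous)

lemma C1_on_const: "C1_on (\<lambda>x. c) S"
  by (rule C1_onI[where f' = "\<lambda>x. 0"]) (auto intro!: derivative_eq_intros)

lemma C1_on_bounded_linear: "bounded_linear f \<Longrightarrow> C1_on f S"
  by (rule C1_onI[where f' = "\<lambda>x. Blinfun f"])
    (auto simp: bounded_linear_Blinfun_apply intro: bounded_linear.has_derivative has_derivative_ident
      bounded_linear_imp_has_derivative)

lemma C1_on_add:
  assumes "C1_on f S" "C1_on g S"
  shows "C1_on (\<lambda>x. f x + g x) S"
proof -
  obtain f' g' where "\<And>x. x \<in> S \<Longrightarrow> (f has_derivative blinfun_apply (f' x)) (at x within S)"
      "continuous_on S f'" "\<And>x. x \<in> S \<Longrightarrow> (g has_derivative blinfun_apply (g' x)) (at x within S)"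
      "continuous_on S g'"
    using assms by (metis C1_onE)
  then show ?thesis
    by (intro C1_onI[where f' = "\<lambda>x. f' x + g' x"])
      (auto intro!: derivative_eq_intros continuous_intros simp: blinfun.add_left)
qed

lemma C1_on_compose:
  assumes "C1_on f S" "C1_on g T" "f ` S \<subseteq> T"
  shows "C1_on (\<lambda>x. g (f x)) S"
proof -
  obtain f' g' where f: "\<And>x. x \<in> S \<Longrightarrow> (f has_derivative blinfun_apply (f' x)) (at x within S)"
      "continuous_on S f'" and
      g: "\<And>x. x \<in> T \<Longrightarrow> (g has_derivative blinfun_apply (g' x)) (at x within T)"
      "continuous_on T g'"
    using assms by (metis C1_onE)
  show ?thesis
  proof (rule C1_onI)
    fix x assume x: "x \<in> S"
    have "(g has_derivative g' (f x)) (at (f x) within f ` S)"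
      by (rule has_derivative_subset[OF g(1)]) (use x assms(3) in auto)
    from has_derivative_in_compose[OF f(1)[OF x] this]
    show "((\<lambda>x. g (f x)) has_derivative (g' (f x) o\<^sub>L f' x)) (at x within S)"
      by (simp add: blinfun_compose.rep_eq o_def)
  next
    have "continuous_on S (\<lambda>x. g' (f x))"
      using continuous_on_compose2[OF g(2) C1_on_imp_continuous_on[OF assms(1)] assms(3)] .
    then show "continuous_on S (\<lambda>x. g' (f x) o\<^sub>L f' x)"
      by (intro bounded_bilinear.continuous_on[OF bounded_bilinear_blinfun_compose] f)
  qed
qed

lemma C1_on_diff:
  fixes f g :: "_ \<Rightarrow> _ :: real_normed_vector"
  assumes "C1_on f S" "C1_on g S"
  shows "C1_on (\<lambda>x. f x - g x) S"
proof -
  have "C1_on (\<lambda>x. - g x) S"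
    by (rule C1_on_compose[OF assms(2) C1_on_bounded_linear[of uminus UNIV]])
      (auto intro: bounded_linear_minus bounded_linear_ident)
  from C1_on_add[OF assms(1) this] show ?thesis by simp
qed

lemma C1_on_Pair:
  assumes "C1_on f S" "C1_on g S"
  shows "C1_on (\<lambda>x. (f x, g x)) S"
proof -
  have "C1_on (\<lambda>x. (f x, 0)) S" "C1_on (\<lambda>x. (0, g x)) S"
    by (rule C1_on_compose[OF assms(1) C1_on_bounded_linear[of _ UNIV]]
          C1_on_compose[OF assms(2) C1_on_bounded_linear[of _ UNIV]];
        auto intro!: bounded_linear_Pair bounded_linear_ident bounded_linear_zero)+
  from C1_on_add[OF this] show ?thesis by simp
qed

text \<open>On an open set the derivative at a point is unique, so derivative maps chosen on
  different neighbourhoods agree where these overlap. The diagonal \<open>L x x\<close> therefore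
  coincides near each \<open>p\<close> with the continuous map \<open>L p\<close>.\<close>

lemma C1_on_open_localI:
  assumes loc: "\<And>p. p \<in> S \<Longrightarrow> \<exists>N. open N \<and> p \<in> N \<and> N \<subseteq> S \<and> C1_on f N"
  shows "C1_on f S"
proof -
  have "\<exists>N L. p \<in> S \<longrightarrow> open N \<and> p \<in> N \<and> N \<subseteq> S \<and> continuous_on N L \<and>
      (\<forall>x\<in>N. (f has_derivative blinfun_apply (L x)) (at x))" for p
    using loc[of p] unfolding C1_on_def by (metis at_within_open)
  then obtain N L where NL: "\<And>p. p \<in> S \<Longrightarrow> open (N p) \<and> p \<in> N p \<and> N p \<subseteq> S \<and> continuous_on (N p) (L p) \<and>
      (\<forall>x\<in>N p. (f has_derivative blinfun_apply (L p x)) (at x))"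
    by metis
  have eq: "L x x = L p x" if "p \<in> S" "x \<in> N p" for p x
  proof -
    have "x \<in> S" using NL that by blast
    then have "(f has_derivative L x x) (at x)" "(f has_derivative L p x) (at x)"
      using NL that by blast+
    then show ?thesis
      using has_derivative_unique blinfun_apply_inject by blast
  qed
  show ?thesis
  proof (rule C1_onI)
    fix x assume "x \<in> S"
    then show "(f has_derivative (L x x)) (at x within S)"
      using NL has_derivative_at_withinI by blast
  next
    have "continuous_on (N p) (\<lambda>x. L x x)" if "p \<in> S" for p
      using NL[OF that] eq[OF that] by (simp cong: continuous_on_cong)
    then have "isCont (\<lambda>x. L x x) p" if "p \<in> S" for p
      using NL that continuous_on_eq_continuous_at by blast
    then show "continuous_on S (\<lambda>x. L x x)"
      by (simp add: continuous_at_imp_continuous_on)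
  qed
qed

section \<open>Mean values, level sets and local sections\<close>

lemma mvt_closed_segment:
  fixes g :: "'a::real_normed_vector \<Rightarrow> real"
  assumes "\<And>z. z \<in> closed_segment p q \<Longrightarrow> (g has_derivative g' z) (at z)"
  shows "\<exists>z\<in>closed_segment p q. g q - g p = g' z (q - p)"
proof -
  define \<gamma> where "\<gamma> = (\<lambda>r. p + r *\<^sub>R (q - p))"
  have seg: "\<gamma> r \<in> closed_segment p q" if "0 \<le> r" "r \<le> 1" for r
    using that by (auto simp: \<gamma>_def in_segment algebra_simps)
  have d: "((\<lambda>r. g (\<gamma> r)) has_derivative (\<lambda>r. g' (\<gamma> r') (r *\<^sub>R (q - p)))) (at r')" if "0 \<le> r'" "r' \<le> 1" for r'
    by (rule has_derivative_compose[of \<gamma> "\<lambda>r. r *\<^sub>R (q - p)", OF _ assms[OF seg[OF that]]])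
      (auto simp: \<gamma>_def intro!: derivative_eq_intros)
  have "\<exists>r\<in>{0<..<1}. g (\<gamma> 1) - g (\<gamma> 0) = g' (\<gamma> r) ((1 - 0) *\<^sub>R (q - p))"
    by (rule mvt_simple) (auto intro: has_derivative_at_withinI d)
  then show ?thesis using seg by (force simp: \<gamma>_def)
qed

text \<open>
  Near a point where the derivative is non-zero, seen from a vantage point displaced along a direction
  of growth, the function increases along every ray, so its level sets are starlike.
\<close>

lemma negligible_regular_level_set:
  fixes g :: "'a::euclidean_space \<Rightarrow> real"
  assumes X: "open X"
    and g': "\<And>x. x \<in> X \<Longrightarrow> (g has_derivative blinfun_apply (g' x)) (at x)"
    and cont: "continuous_on X g'"
    and nz: "\<And>x. x \<in> X \<Longrightarrow> g' x \<noteq> 0"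
  shows "negligible {x \<in> X. g x = c}"
proof (subst locally_negligible_alt, intro ballI)
  fix x0 assume "x0 \<in> {x \<in> X. g x = c}"
  then have x0: "x0 \<in> X" "g x0 = c" by auto
  obtain w where w: "g' x0 w \<noteq> 0"
    using nz[OF x0(1)] by (metis blinfun_eqI zero_blinfun.rep_eq)
  define v where "v = (if g' x0 w > 0 then w else - w)"
  have v: "g' x0 v > 0" using w by (auto simp: v_def blinfun.minus_right)
  \<comment> \<open>The vantage point: seen from \<open>a\<close>, the point \<open>x0\<close> lies
    in the direction \<open>v\<close>, along which \<open>g\<close> grows.\<close>
  define a where "a = x0 - v"
  \<comment> \<open>Base point and target point vary independently because the mean value theorem
    evaluates the derivative at a point \<open>z\<close> other than the end points. Openness of
    \<open>P\<close> gives one ball that serves both.\<close>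
  define P where "P = {p \<in> X \<times> UNIV. 0 < g' (fst p) (snd p - a)}"
  have gfst: "continuous_on (X \<times> UNIV) (\<lambda>p. g' (fst p))"
    by (rule continuous_on_compose2[OF cont continuous_on_fst]) auto
  have "continuous_on (X \<times> UNIV) (\<lambda>p. g' (fst p) (snd p - a))"
    by (intro continuous_intros gfst)
  from continuous_open_preimage[OF this open_Times[OF X open_UNIV] open_greaterThan[of 0]]
  have "open P" by (simp add: P_def vimage_def Int_def mem_Times_iff)
  moreover have "(x0, x0) \<in> P" using x0 v by (simp add: P_def a_def)
  ultimately obtain A B where AB: "open A" "x0 \<in> A" "open B" "x0 \<in> B" "A \<times> B \<subseteq> P"
    using open_prod_elim by (metis mem_Sigma_iff)
  then obtain e where e: "e > 0" "cball x0 e \<subseteq> A \<inter> B"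
    by (meson IntI open_Int open_contains_cball)
  have pos: "g' z (p - a) > 0" and inX: "z \<in> X" if "z \<in> cball x0 e" "p \<in> cball x0 e" for z p
  proof -
    have "(z, p) \<in> P" using AB(5) e(2) that by blast
    then show "g' z (p - a) > 0" "z \<in> X" by (auto simp: P_def)
  qed
  let ?T = "{x \<in> cball x0 e. g x = c}"
  have "continuous_on (cball x0 e) g"
    by (meson continuous_at_imp_continuous_on g' has_derivative_continuous inX centre_in_cball e(1) less_imp_le)
  then have "closed ?T"
    using continuous_closed_preimage[of "cball x0 e" g "{c}"] by (simp add: vimage_def Int_def)
  have "negligible ?T"
  proof (rule starlike_negligible[OF \<open>closed ?T\<close>, of a])
    fix r x assume T: "a + r *\<^sub>R x \<in> ?T" and "0 \<le> r" and T': "a + x \<in> ?T"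
    have sub: "closed_segment (a + x) (a + r *\<^sub>R x) \<subseteq> cball x0 e"
      using T T' by (intro closed_segment_subset) auto
    have "\<exists>z\<in>closed_segment (a + x) (a + r *\<^sub>R x). g (a + r *\<^sub>R x) - g (a + x) = g' z ((a + r *\<^sub>R x) - (a + x))"
      by (rule mvt_closed_segment) (use sub inX g' T' in blast)
    then obtain z where z: "z \<in> closed_segment (a + x) (a + r *\<^sub>R x)" "g' z ((r - 1) *\<^sub>R x) = 0"
      using T T' by (auto simp: algebra_simps)
    have "z \<in> cball x0 e" using z(1) sub by blast
    from pos[OF this, of "a + x"] T' have "g' z x > 0" by simp
    with z(2) show "r = 1" by (simp add: blinfun.scaleR_right)
  qed
  then show "\<exists>U. openin (top_of_set {x \<in> X. g x = c}) U \<and> x0 \<in> U \<and> negligible U"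
    using x0 e(1)
    by (intro exI[of _ "{x \<in> X. g x = c} \<inter> ball x0 e"])
       (auto intro: negligible_subset openin_open_Int)
qed

text \<open>Along a line through \<open>x0\<close> in a direction with non-zero derivative,
  \<open>f\<close> becomes a function of one real variable with invertible derivative. Its local
  inverse, carried back to the line, is the section.\<close>

lemma C1_local_section:
  fixes f :: "'a::real_normed_vector \<Rightarrow> real"
  assumes X: "open X"
    and f': "\<And>x. x \<in> X \<Longrightarrow> (f has_derivative blinfun_apply (f' x)) (at x)"
    and cont: "continuous_on X f'"
    and x0: "x0 \<in> X" "f' x0 \<noteq> 0"
  obtains V \<xi> where "open V" "f x0 \<in> V" "C1_on \<xi> V" "\<xi> ` V \<subseteq> X" "\<And>i. i \<in> V \<Longrightarrow> f (\<xi> i) = i"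
proof -
  obtain v where v: "f' x0 v \<noteq> 0"
    using x0(2) by (metis blinfun_eqI zero_blinfun.rep_eq)
  define \<gamma> where "\<gamma> = (\<lambda>t. x0 + t *\<^sub>R v)"
  define L where "L = Blinfun (\<lambda>t. t *\<^sub>R v)"
  have L: "blinfun_apply L = (\<lambda>t. t *\<^sub>R v)"
    unfolding L_def by (rule bounded_linear_Blinfun_apply) (rule bounded_linear_scaleR_left)
  define U where "U = \<gamma> -` X"
  have cont_\<gamma>: "continuous_on A \<gamma>" for A unfolding \<gamma>_def by (intro continuous_intros)
  have U: "open U" unfolding U_def by (rule open_vimage[OF X cont_\<gamma>])
  define \<phi>' where "\<phi>' = (\<lambda>t. f' (\<gamma> t) o\<^sub>L L)"
  have \<phi>: "((\<lambda>t. f (\<gamma> t)) has_derivative blinfun_apply (\<phi>' t)) (at t)" if "t \<in> U" for t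
  proof -
    have "(\<gamma> has_derivative blinfun_apply L) (at t)"
      unfolding \<gamma>_def L by (auto intro!: derivative_eq_intros)
    from has_derivative_compose[OF this f'] that show ?thesis
      by (simp add: U_def \<phi>'_def blinfun_compose.rep_eq o_def)
  qed
  have cont_\<phi>': "continuous_on U \<phi>'"
    unfolding \<phi>'_def
    by (intro bounded_bilinear.continuous_on[OF bounded_bilinear_blinfun_compose]
        continuous_on_compose2[OF cont cont_\<gamma>] continuous_on_const) (auto simp: U_def)
  have "0 \<in> U" by (simp add: U_def \<gamma>_def x0)
  \<comment> \<open>In one dimension the derivative is multiplication by \<open>f' x0 v\<close>, so
    the reciprocal inverts it.\<close>
  have "(inverse (f' x0 v) *\<^sub>R id_blinfun) o\<^sub>L \<phi>' 0 = id_blinfun"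
    using v by (intro blinfun_eqI) (simp add: \<phi>'_def L \<gamma>_def blinfun.scaleR_left blinfun.scaleR_right)
  from inverse_function_theorem[OF U \<phi> cont_\<phi>' \<open>0 \<in> U\<close> this]
  obtain U' V \<psi> \<psi>' where V: "open V" "f (\<gamma> 0) \<in> V" and U': "U' \<subseteq> U"
    and hom: "homeomorphism U' V (\<lambda>t. f (\<gamma> t)) \<psi>"
    and \<psi>: "\<And>i. i \<in> V \<Longrightarrow> (\<psi> has_derivative \<psi>' i) (at i)"
    and inv: "\<And>i. i \<in> V \<Longrightarrow> \<psi>' i = inv (blinfun_apply (\<phi>' (\<psi> i)))"
    and bij: "\<And>i. i \<in> V \<Longrightarrow> bij (blinfun_apply (\<phi>' (\<psi> i)))"
    by metis
  have \<psi>U: "\<psi> i \<in> U" and sec: "f (\<gamma> (\<psi> i)) = i" if "i \<in> V" for i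
    using hom U' that unfolding homeomorphism_def by auto
  have nz: "\<phi>' (\<psi> i) 1 \<noteq> 0" if "i \<in> V" for i
    using bij[OF that] by (metis bij_pointE blinfun.zero_right zero_neq_one)
  have cont_\<psi>: "continuous_on V \<psi>" using hom by (simp add: homeomorphism_def)
  have "C1_on \<psi> V"
  proof (rule C1_onI)
    fix i assume i: "i \<in> V"
    have scale: "\<phi>' (\<psi> i) t = t * \<phi>' (\<psi> i) 1" for t
      using blinfun.scaleR_right[of "\<phi>' (\<psi> i)" t 1] by simp
    \<comment> \<open>The inverse function theorem describes the derivative of \<open>\<psi>\<close>
      only as a pointwise inverse map. As a reciprocal multiple of the identity it visibly depends
      continuously on \<open>i\<close>.\<close>
    have "\<psi>' i = blinfun_apply (inverse (\<phi>' (\<psi> i) 1) *\<^sub>R id_blinfun)"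
      unfolding inv[OF i]
    proof
      fix t
      have "\<phi>' (\<psi> i) (inverse (\<phi>' (\<psi> i) 1) * t) = t"
        using nz[OF i] scale[of "inverse (\<phi>' (\<psi> i) 1) * t"] by simp
      then show "inv (blinfun_apply (\<phi>' (\<psi> i))) t = (inverse (\<phi>' (\<psi> i) 1) *\<^sub>R id_blinfun) t"
        by (simp add: blinfun.scaleR_left inv_f_eq[OF bij_is_inj[OF bij[OF i]]])
    qed
    then show "(\<psi> has_derivative blinfun_apply (inverse (\<phi>' (\<psi> i) 1) *\<^sub>R id_blinfun)) (at i within V)"
      using has_derivative_at_withinI[OF \<psi>[OF i]] by (simp only:)
  next
    have "continuous_on V (\<lambda>i. \<phi>' (\<psi> i))"
      by (rule continuous_on_compose2[OF cont_\<phi>' cont_\<psi>]) (use \<psi>U in auto)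
    then show "continuous_on V (\<lambda>i. inverse (\<phi>' (\<psi> i) 1) *\<^sub>R (id_blinfun :: real \<Rightarrow>\<^sub>L real))"
      by (intro continuous_intros) (use nz in auto)
  qed
  moreover have "C1_on \<gamma> UNIV"
    unfolding \<gamma>_def by (intro C1_on_add C1_on_const C1_on_bounded_linear bounded_linear_scaleR_left)
  ultimately have "C1_on (\<lambda>i. \<gamma> (\<psi> i)) V" by (rule C1_on_compose) simp
  moreover have "(\<lambda>i. \<gamma> (\<psi> i)) ` V \<subseteq> X" using \<psi>U by (auto simp: U_def)
  moreover have "f x0 \<in> V" using V(2) by (simp add: \<gamma>_def)
  ultimately show ?thesis using V(1) sec that by blast
qed

section \<open>Absolutely continuous probability measures\<close>

lemma emeasure_lborel_bounded_less_top:
  "bounded (W :: 'a::euclidean_space set) \<Longrightarrow> emeasure lborel W < \<infinity>"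
  using emeasure_bounded_finite by auto

lemma measure_lborel_open_pos:
  fixes W :: "'a::euclidean_space set"
  assumes "open W" "bounded W" "W \<noteq> {}"
  shows "measure lborel W > 0"
proof -
  have "W \<notin> null_sets lborel"
    using open_not_negligible[OF assms(1,3)] by (auto simp: negligible_iff_null_sets intro: null_sets_completionI)
  then have "emeasure lborel W \<noteq> 0" using assms by (auto simp: null_sets_def)
  then show ?thesis
    using emeasure_lborel_bounded_less_top[OF assms(2)]
    by (simp add: measure_def enn2real_positive_iff zero_less_iff_neq_zero)
qed

text \<open>The average of the uniform distributions on \<open>U\<close> and \<open>V\<close>,
  realised by a weighted sum of indicators as density. It supplies the test measures on both
  \<open>X\<close> and \<open>Y\<close> that detect a reversed order.\<close>

lemma ac_prob_two_pieces:
  fixes S U V :: "'a::euclidean_space set"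
  assumes S: "S \<in> sets borel" and U: "open U" "bounded U" "U \<noteq> {}" "U \<subseteq> S"
    and V: "open V" "bounded V" "V \<noteq> {}" "V \<subseteq> S"
  obtains M where "ac_prob_on S M"
    "\<And>A. A \<in> sets borel \<Longrightarrow> A \<subseteq> S \<Longrightarrow> measure M A =
      (measure lborel (U \<inter> A) / measure lborel U + measure lborel (V \<inter> A) / measure lborel V) / 2"
proof -
  let ?N = "restrict_space lborel S"
  define a where "a = 1 / (2 * measure lborel U)"
  define b where "b = 1 / (2 * measure lborel V)"
  have fin: "emeasure lborel (W \<inter> A) = ennreal (measure lborel (W \<inter> A))"
    if "W = U \<or> W = V" "A \<in> sets borel" for W A :: "'a set"
  proof -
    have "bounded (W \<inter> A)" using U V that by (auto intro: bounded_subset)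
    then show ?thesis
      using emeasure_lborel_bounded_less_top by (intro emeasure_eq_ennreal_measure) (auto simp: less_top)
  qed
  have pos: "measure lborel U > 0" "measure lborel V > 0"
    using U V by (auto intro: measure_lborel_open_pos)
  have ab: "0 \<le> a" "0 \<le> b" by (simp_all add: a_def b_def)
  define f where "f x = ennreal a * indicator U x + ennreal b * indicator V x" for x
  have N: "U \<in> sets ?N" "V \<in> sets ?N"
    using U V S by (auto simp: sets_restrict_space_iff)
  then have f: "f \<in> borel_measurable ?N" unfolding f_def by measurable
  define M where "M = density ?N f"
  have em: "emeasure M A = ennreal (a * measure lborel (U \<inter> A) + b * measure lborel (V \<inter> A))"
    if A: "A \<in> sets borel" "A \<subseteq> S" for A
  proof -
    have AN: "A \<in> sets ?N" using A S by (auto simp: sets_restrict_space_iff)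
    have "emeasure M A = (\<integral>\<^sup>+x. ennreal a * indicator (U \<inter> A) x + ennreal b * indicator (V \<inter> A) x \<partial>?N)"
      unfolding M_def emeasure_density[OF f AN] f_def
      by (intro nn_integral_cong) (auto simp: indicator_def)
    also have "\<dots> = ennreal a * emeasure ?N (U \<inter> A) + ennreal b * emeasure ?N (V \<inter> A)"
      using N AN by (subst nn_integral_add) (auto simp: nn_integral_cmult_indicator)
    also have "\<dots> = ennreal a * emeasure lborel (U \<inter> A) + ennreal b * emeasure lborel (V \<inter> A)"
      using S A by (subst (1 2) emeasure_restrict_space) auto
    also have "\<dots> = ennreal (a * measure lborel (U \<inter> A) + b * measure lborel (V \<inter> A))"
      using fin[of U A] fin[of V A] A by (simp add: ennreal_mult ennreal_plus ab)
    finally show ?thesis .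
  qed
  show ?thesis
  proof (rule that)
    have sp: "space M = S" using S by (simp add: M_def space_restrict_space)
    have "emeasure M (space M) = 1"
      unfolding sp using em[OF S] U V pos
      by (simp add: a_def b_def Int_absorb2 field_simps)
    then have "prob_space M" by (rule prob_spaceI)
    then show "ac_prob_on S M"
      unfolding ac_prob_on_def using f
      by (auto simp: M_def sets_restrict_space intro: absolutely_continuousI_density)
    show "measure M A = (measure lborel (U \<inter> A) / measure lborel U + measure lborel (V \<inter> A) / measure lborel V) / 2"
      if "A \<in> sets borel" "A \<subseteq> S" for A
      using measure_eq_emeasure_eq_ennreal[OF _ em[OF that]] ab
      by (simp add: a_def b_def field_simps)
  qed
qed

section \<open>The common order\<close>

locale nondegenerate_C2 =
  fixes X :: "'a::euclidean_space set" and Y :: "real set" and s :: "'a \<times> real \<Rightarrow> real"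
  assumes open_X: "open X" and open_Y: "open Y" and connected_Y: "connected Y"
    and C2: "C2_bounded_on s (X \<times> Y)"
    and nondeg: "nondegenerate X Y s"
begin

abbreviation "g \<equiv> s_y s"

text \<open>Evaluating the total derivative of \<open>s\<close> in the direction
  \<open>(0, 1)\<close> gives \<open>s_y\<close>. Evaluation is bounded linear, so
  \<open>s_y\<close> inherits joint continuous differentiability from the total derivative.\<close>

lemma C1_s_and_g:
  shows C1_s: "C1_on s (X \<times> Y)"
    and C1_g: "C1_on (\<lambda>p. g (fst p) (snd p)) (X \<times> Y)"
    and g_has_derivative: "x \<in> X \<Longrightarrow> y \<in> Y \<Longrightarrow> ((\<lambda>t. s (x, t)) has_real_derivative g x y) (at y)"
proof -
  obtain f' :: "'a \<times> real \<Rightarrow> ('a \<times> real) \<Rightarrow>\<^sub>L real"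
    and f'' :: "'a \<times> real \<Rightarrow> ('a \<times> real) \<Rightarrow>\<^sub>L (('a \<times> real) \<Rightarrow>\<^sub>L real)" where
    f': "\<And>p. p \<in> X \<times> Y \<Longrightarrow> (s has_derivative f' p) (at p within X \<times> Y)" and
    f'': "\<And>p. p \<in> X \<times> Y \<Longrightarrow> (f' has_derivative f'' p) (at p within X \<times> Y)" and
    cont: "continuous_on (X \<times> Y) f''"
    using C2 unfolding C2_bounded_on_def by blast
  have C1_f': "C1_on f' (X \<times> Y)" using f'' cont by (rule C1_onI)
  show "C1_on s (X \<times> Y)"
    by (rule C1_onI[OF f' C1_on_imp_continuous_on[OF C1_f']])
  have d: "((\<lambda>t. s (x, t)) has_real_derivative f' (x, y) (0, 1)) (at y)" if "x \<in> X" "y \<in> Y" for x y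
  proof -
    have "(s has_derivative f' (x, y)) (at (x, y))"
      using f'[of "(x, y)"] at_within_open[OF _ open_Times[OF open_X open_Y]] that by auto
    then have "((\<lambda>t. s (x, t)) has_derivative (\<lambda>t. f' (x, y) (0, t))) (at y)"
      by (rule has_derivative_compose[rotated]) (auto intro!: derivative_eq_intros)
    moreover have "(\<lambda>t. f' (x, y) (0, t)) = (*) (f' (x, y) (0, 1))"
    proof
      fix t show "f' (x, y) (0, t) = f' (x, y) (0, 1) * t"
        using blinfun.scaleR_right[of "f' (x, y)" t "(0, 1)"] by simp
    qed
    ultimately show ?thesis by (simp only: has_field_derivative_def)
  qed
  then have g: "g x y = f' (x, y) (0, 1)" if "x \<in> X" "y \<in> Y" for x y
    using that unfolding s_y_def by (auto intro: DERIV_imp_deriv)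
  show "((\<lambda>t. s (x, t)) has_real_derivative g x y) (at y)" if "x \<in> X" "y \<in> Y"
    using d[OF that] g[OF that] by simp
  have "C1_on (\<lambda>p. f' p (0, 1)) (X \<times> Y)"
    by (rule C1_on_compose[OF C1_f' C1_on_bounded_linear[of _ UNIV]])
      (auto intro: blinfun.bounded_linear_left)
  then show "C1_on (\<lambda>p. g (fst p) (snd p)) (X \<times> Y)"
    by (rule C1_on_cong[THEN iffD1, rotated]) (auto simp: g)
qed

lemma C1_on_section:
  assumes "C1_on f (X \<times> Y)" "y \<in> Y"
  shows "C1_on (\<lambda>x. f (x, y)) X"
proof (rule C1_on_compose[OF _ assms(1)])
  show "C1_on (\<lambda>x. (x, y)) X"
    by (intro C1_on_Pair C1_on_const C1_on_bounded_linear bounded_linear_ident)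
qed (use assms in auto)

lemma C1_g_section: "y \<in> Y \<Longrightarrow> C1_on (\<lambda>x. g x y) X"
  using C1_on_section[OF C1_g] by simp

lemma continuous_on_g: "y \<in> Y \<Longrightarrow> continuous_on X (\<lambda>x. g x y)"
  by (rule C1_on_imp_continuous_on[OF C1_g_section])

lemma continuous_on_g_y:
  assumes "x \<in> X"
  shows "continuous_on Y (g x)"
proof -
  have "continuous_on Y (\<lambda>y. (x, y))" "(\<lambda>y. (x, y)) ` Y \<subseteq> X \<times> Y"
    using assms by (auto intro!: continuous_intros)
  from continuous_on_compose2[OF C1_on_imp_continuous_on[OF C1_g] this] show ?thesis by simp
qed

text \<open>Turns non-degeneracy, which is phrased with \<open>frechet_derivative\<close>, into a
  continuous field of non-zero bounded linear maps, as the calculus lemmas expect.\<close>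

lemma g_regular:
  assumes "y \<in> Y"
  obtains g' where "\<And>x. x \<in> X \<Longrightarrow> ((\<lambda>x. g x y) has_derivative blinfun_apply (g' x)) (at x)"
    "continuous_on X g'" "\<And>x. x \<in> X \<Longrightarrow> g' x \<noteq> 0"
proof -
  obtain g' where g': "\<And>x. x \<in> X \<Longrightarrow> ((\<lambda>x. g x y) has_derivative blinfun_apply (g' x)) (at x within X)"
    "continuous_on X g'"
    using C1_onE[OF C1_g_section[OF assms]] by blast
  have d: "((\<lambda>x. g x y) has_derivative blinfun_apply (g' x)) (at x)" if "x \<in> X" for x
    using g'(1)[OF that] unfolding at_within_open[OF that open_X] .
  have "g' x \<noteq> 0" if "x \<in> X" for x
  proof
    assume "g' x = 0"
    then have "blinfun_apply (g' x) = (\<lambda>v. 0)" by (simp add: zero_blinfun.rep_eq)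
    with d[OF that] have "((\<lambda>x. g x y) has_derivative (\<lambda>v. 0)) (at x)" by (simp only:)
    from frechet_derivative_at[OF this] show False
      using nondeg that assms unfolding nondegenerate_def by auto
  qed
  with d g'(2) show ?thesis using that by blast
qed

text \<open>At a local extremum the derivative would vanish, against non-degeneracy. The comparison
  arguments below use non-degeneracy in this form.\<close>

lemma g_not_extremal:
  assumes "x \<in> X" "y \<in> Y" "open N" "x \<in> N"
  shows ex_g_greater: "\<exists>z\<in>N \<inter> X. g x y < g z y" and ex_g_less: "\<exists>z\<in>N \<inter> X. g z y < g x y"
proof -
  obtain g' where g': "\<And>x. x \<in> X \<Longrightarrow> ((\<lambda>x. g x y) has_derivative blinfun_apply (g' x)) (at x)"
    "continuous_on X g'" "\<And>x. x \<in> X \<Longrightarrow> g' x \<noteq> 0"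
    by (rule g_regular[OF assms(2)]) (rule that)
  have *: "\<not> ((\<forall>z\<in>N \<inter> X. g z y \<le> g x y) \<or> (\<forall>z\<in>N \<inter> X. g x y \<le> g z y))"
  proof
    assume "(\<forall>z\<in>N \<inter> X. g z y \<le> g x y) \<or> (\<forall>z\<in>N \<inter> X. g x y \<le> g z y)"
    from differential_zero_maxmin[OF _ _ g'(1)[OF assms(1)] this] assms open_X
    have "blinfun_apply (g' x) = (\<lambda>v. 0)" by blast
    then have "g' x = 0" by (intro blinfun_eqI) simp
    with g'(3)[OF assms(1)] show False by blast
  qed
  then show "\<exists>z\<in>N \<inter> X. g x y < g z y" "\<exists>z\<in>N \<inter> X. g z y < g x y"
    by (meson not_less)+
qed

lemma negligible_g_level: "y \<in> Y \<Longrightarrow> negligible {x \<in> X. g x y = c}"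
  by (erule g_regular, rule negligible_regular_level_set[OF open_X])

text \<open>Since \<open>y\<close> and \<open>y'\<close> are arbitrary, the implication is in effect
  an equivalence; with \<open>x\<close> and \<open>z\<close> exchanged it also preserves
  ties.\<close>

definition same_order :: bool where
  "same_order \<longleftrightarrow> (\<forall>x\<in>X. \<forall>z\<in>X. \<forall>y\<in>Y. \<forall>y'\<in>Y. g x y < g z y \<longrightarrow> g x y' < g z y')"

lemma same_orderD:
  "same_order \<Longrightarrow> x \<in> X \<Longrightarrow> z \<in> X \<Longrightarrow> y \<in> Y \<Longrightarrow> y' \<in> Y \<Longrightarrow> g x y < g z y \<longleftrightarrow> g x y' < g z y'"
  unfolding same_order_def by blast

section \<open>Pseudo-index form\<close>

lemma pseudo_index_form_imp_same_order:
  assumes "connected X" "pseudo_index_form X Y s"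
  shows same_order
proof -
  obtain \<alpha> I and \<sigma> :: "real \<times> real \<Rightarrow> real" where I: "C1_on I X" and \<sigma>: "C1_on \<sigma> (I ` X \<times> Y)"
    and eq: "\<forall>x\<in>X. \<forall>y\<in>Y. s (x, y) = \<alpha> x + \<sigma> (I x, y)"
    using assms(2) unfolding pseudo_index_form_def by blast
  obtain \<sigma>' where \<sigma>': "\<And>p. p \<in> I ` X \<times> Y \<Longrightarrow> (\<sigma> has_derivative blinfun_apply (\<sigma>' p)) (at p within I ` X \<times> Y)"
    and cont_\<sigma>': "continuous_on (I ` X \<times> Y) \<sigma>'"
    using C1_onE[OF \<sigma>] by blast
  \<comment> \<open>The partial derivative of \<open>\<sigma>\<close> in its second argument, read
    off from the derivative within the domain, as the image of \<open>I\<close> is not known to be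
    open here.\<close>
  define h where "h i y = \<sigma>' (i, y) (0, 1)" for i y
  have g_eq: "g x y = h (I x) y" if x: "x \<in> X" and y: "y \<in> Y" for x y
  proof -
    have "(\<sigma> has_derivative \<sigma>' (I x, y)) (at (I x, y) within Pair (I x) ` Y)"
      by (rule has_derivative_subset[OF \<sigma>']) (use x y in auto)
    then have "((\<lambda>t. \<sigma> (I x, t)) has_derivative (\<lambda>t. \<sigma>' (I x, y) (0, t))) (at y within Y)"
      by (rule has_derivative_in_compose[rotated]) (auto intro!: derivative_eq_intros)
    then have "((\<lambda>t. \<alpha> x + \<sigma> (I x, t)) has_derivative (\<lambda>t. \<sigma>' (I x, y) (0, t))) (at y within Y)"
      by (auto intro!: derivative_eq_intros)
    then have "((\<lambda>t. s (x, t)) has_derivative (\<lambda>t. \<sigma>' (I x, y) (0, t))) (at y within Y)"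
      by (rule has_derivative_transform[OF y, rotated]) (use x eq in blast)
    then have "((\<lambda>t. s (x, t)) has_derivative (\<lambda>t. \<sigma>' (I x, y) (0, t))) (at y)"
      unfolding at_within_open[OF y open_Y] .
    from has_derivative_unique[OF this g_has_derivative[OF x y, unfolded has_field_derivative_def]]
    have "\<sigma>' (I x, y) (0, 1) = g x y * 1" by (rule fun_cong)
    then show ?thesis by (simp add: h_def)
  qed
  have "connected (I ` X)"
    using connected_continuous_image[OF C1_on_imp_continuous_on[OF I] assms(1)] .
  note IX = connected_contains_Icc[OF this]
  have cont_h: "continuous_on (I ` X) (\<lambda>i. h i y)" if "y \<in> Y" for y
    unfolding h_def using that
    by (intro continuous_intros continuous_on_compose2[OF cont_\<sigma>']) auto
  have inj: "h i y \<noteq> h j y" if ij: "i \<in> I ` X" "j \<in> I ` X" "i < j" and y: "y \<in> Y" for i j y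
  proof
    assume hij: "h i y = h j y"
    have sub: "{i..j} \<subseteq> I ` X" using IX[OF ij(1,2)] .
    \<comment> \<open>The points that \<open>I\<close> maps into the open interval from
      \<open>i\<close> to \<open>j\<close> form a neighbourhood of any \<open>x\<close> over
      \<open>k\<close>. There \<open>g\<close> takes values on both sides of \<open>g x y\<close>,
      hence so does \<open>h\<close> on the interval.\<close>
    have no_extr: "\<not> ((\<forall>l\<in>{i..j}. h l y \<le> h k y) \<or> (\<forall>l\<in>{i..j}. h k y \<le> h l y))" if k: "i < k" "k < j" for k
    proof -
      obtain x where x: "x \<in> X" "I x = k" using k subsetD[OF sub, of k] by auto
      have "open (X \<inter> I -` {i<..<j})"
        by (intro continuous_open_preimage C1_on_imp_continuous_on[OF I] open_X) auto
      from g_not_extremal[OF x(1) y this] x k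
      obtain u v where "u \<in> X" "I u \<in> {i<..<j}" "g x y < g u y" "v \<in> X" "I v \<in> {i<..<j}" "g v y < g x y"
        by auto
      then have "h k y < h (I u) y" "I u \<in> {i..j}" "h (I v) y < h k y" "I v \<in> {i..j}"
        using x y by (auto simp: g_eq)
      then show ?thesis by (meson not_less)
    qed
    have c: "continuous_on {i..j} (\<lambda>l. h l y)" using cont_h[OF y] sub continuous_on_subset by blast
    obtain k where k: "k \<in> {i..j}" "\<forall>l\<in>{i..j}. h l y \<le> h k y"
      using continuous_attains_sup[OF compact_Icc _ c] ij by auto
    obtain k' where k': "k' \<in> {i..j}" "\<forall>l\<in>{i..j}. h k' y \<le> h l y"
      using continuous_attains_inf[OF compact_Icc _ c] ij by auto
    \<comment> \<open>Maximum and minimum both sit at end points, where \<open>h\<close> takes a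
      single value. So \<open>h\<close> is constant, which makes any interior point extremal after
      all.\<close>
    have "k = i \<or> k = j" "k' = i \<or> k' = j" using no_extr[of k] no_extr[of k'] k k' by (auto simp: order.order_iff_strict)
    then have const: "h l y = h i y" if "l \<in> {i..j}" for l
      using hij k k' that by (auto intro!: order_antisym)
    obtain m where m: "i < m" "m < j" using ij(3) dense by blast
    have "h l y \<le> h m y" if "l \<in> {i..j}" for l
      unfolding const[OF that] using const[of m] m by simp
    with no_extr[OF m] show False by blast
  qed
  show same_order
    unfolding same_order_def
  proof (intro ballI impI)
    fix x z y y' assume xz: "x \<in> X" "z \<in> X" and y: "y \<in> Y" "y' \<in> Y" and less: "g x y < g z y"
    have "I x \<noteq> I z" using less g_eq xz y by fastforce
    \<comment> \<open>That \<open>I x\<close> and \<open>I z\<close> differ is a statement without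
      \<open>t\<close>, so injectivity rules out a tie at every \<open>t\<close>. The difference
      then has no zero on the connected set \<open>Y\<close> and keeps its sign.\<close>
    then have nz: "g x t \<noteq> g z t" if "t \<in> Y" for t
      using inj[of "I x" "I z" t] inj[of "I z" "I x" t] xz that by (auto simp: g_eq neq_iff)
    have "connected ((\<lambda>t. g z t - g x t) ` Y)"
      by (intro connected_continuous_image connected_Y continuous_intros continuous_on_g_y xz)
    then have "0 \<in> (\<lambda>t. g z t - g x t) ` Y" if "g z y' \<le> g x y'"
      using connectedD_interval[of _ "g z y' - g x y'" "g z y - g x y" 0] that less y by auto
    then show "g x y' < g z y'" using nz by (fastforce simp: not_le)
  qed
qed

text \<open>A tie at \<open>y0\<close> is a tie at every \<open>t\<close>, so the difference of the
  two functions of \<open>t\<close> has zero derivative on the connected set \<open>Y\<close> and is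
  constant.\<close>

lemma same_order_increment_eq:
  assumes same_order "x \<in> X" "z \<in> X" "y0 \<in> Y" "y \<in> Y" "g x y0 = g z y0"
  shows "s (x, y) - s (x, y0) = s (z, y) - s (z, y0)"
proof -
  have g_eq: "g x t = g z t" if "t \<in> Y" for t
    using same_orderD[OF assms(1), of x z y0 t] same_orderD[OF assms(1), of z x y0 t] assms that
    by auto
  have "((\<lambda>t. s (x, t) - s (z, t)) has_derivative (\<lambda>v. 0)) (at t)" if "t \<in> Y" for t
  proof -
    have "((\<lambda>t. s (x, t) - s (z, t)) has_real_derivative g x t - g z t) (at t)"
      by (intro DERIV_diff g_has_derivative assms that)
    then show ?thesis by (simp add: g_eq[OF that] has_field_derivative_def lambda_zero)
  qed
  from has_derivative_zero_unique_connected[OF open_Y connected_Y this assms(5,4)]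
  show ?thesis by simp
qed

lemma same_order_imp_pseudo_index_form:
  assumes so: same_order and y0: "y0 \<in> Y"
  shows "pseudo_index_form X Y s"
proof -
  define I where "I = (\<lambda>x. g x y0)"
  \<comment> \<open>An arbitrary choice of representative without any regularity; equality of
    increments makes \<open>\<sigma>\<close> independent of it.\<close>
  define r where "r i = (SOME x. x \<in> X \<and> I x = i)" for i
  define \<sigma> where "\<sigma> p = s (r (fst p), snd p) - s (r (fst p), y0)" for p
  have \<sigma>_eq: "\<sigma> (I x, y) = s (x, y) - s (x, y0)" if "x \<in> X" "y \<in> Y" for x y
  proof -
    have "r (I x) \<in> X \<and> I (r (I x)) = I x"
      unfolding r_def by (rule someI[of _ x]) (use that in simp)
    then show ?thesis
      unfolding \<sigma>_def fst_conv snd_conv using so that y0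
      by (intro same_order_increment_eq) (auto simp: I_def)
  qed
  obtain I' where I': "\<And>x. x \<in> X \<Longrightarrow> (I has_derivative blinfun_apply (I' x)) (at x)"
    "continuous_on X I'" "\<And>x. x \<in> X \<Longrightarrow> I' x \<noteq> 0"
    by (rule g_regular[OF y0, folded I_def]) (rule that)
  have "C1_on \<sigma> (I ` X \<times> Y)"
  proof (rule C1_on_open_localI)
    fix p assume "p \<in> I ` X \<times> Y"
    then obtain x y where p: "p = (I x, y)" and x: "x \<in> X" and y: "y \<in> Y" by auto
    \<comment> \<open>Near \<open>p\<close> the irregular \<open>r\<close> may be exchanged for a
      section \<open>\<xi>\<close> of class C1, which exhibits \<open>\<sigma>\<close> as a C1
      function there.\<close>
    obtain V \<xi> where V: "open V" "I x \<in> V" and \<xi>: "C1_on \<xi> V" "\<xi> ` V \<subseteq> X" "\<And>i. i \<in> V \<Longrightarrow> I (\<xi> i) = i"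
      by (rule C1_local_section[OF open_X _ I'(2) x I'(3)[OF x]]) (erule I'(1), rule that)
    have \<xi>X: "\<xi> i \<in> X" if "i \<in> V" for i using \<xi>(2) that by auto
    have fst: "C1_on (\<lambda>p. \<xi> (fst p)) (V \<times> Y)"
      by (rule C1_on_compose[OF C1_on_bounded_linear[OF bounded_linear_fst] \<xi>(1)]) auto
    have "C1_on (\<lambda>p. s (\<xi> (fst p), snd p) - s (\<xi> (fst p), y0)) (V \<times> Y)"
      by (intro C1_on_diff C1_on_compose[OF _ C1_s] C1_on_Pair fst C1_on_const
          C1_on_bounded_linear bounded_linear_snd) (use \<xi>X y0 in auto)
    then have "C1_on \<sigma> (V \<times> Y)"
    proof (rule C1_on_cong[THEN iffD1, rotated])
      fix p assume "p \<in> V \<times> Y"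
      then show "s (\<xi> (fst p), snd p) - s (\<xi> (fst p), y0) = \<sigma> p"
        using \<sigma>_eq[of "\<xi> (fst p)" "snd p"] \<xi>X \<xi>(3) by auto
    qed
    moreover have "V \<subseteq> I ` X" using \<xi>X \<xi>(3) by (metis image_eqI subsetI)
    ultimately show "\<exists>N. open N \<and> p \<in> N \<and> N \<subseteq> I ` X \<times> Y \<and> C1_on \<sigma> N"
      using V y open_Y p by (intro exI[of _ "V \<times> Y"]) (auto intro: open_Times)
  qed
  moreover have "C1_on I X" unfolding I_def by (rule C1_g_section[OF y0])
  moreover have "C1_on (\<lambda>x. s (x, y0)) X" by (rule C1_on_section[OF C1_s y0])
  moreover have "\<forall>x\<in>X. \<forall>y\<in>Y. s (x, y) = s (x, y0) + \<sigma> (I x, y)" using \<sigma>_eq by auto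
  ultimately show ?thesis unfolding pseudo_index_form_def by blast
qed

section \<open>Nestedness\<close>

lemma open_g_greater: "y \<in> Y \<Longrightarrow> open {x \<in> X. k < ereal (g x y)}"
  and open_g_less: "y \<in> Y \<Longrightarrow> open {x \<in> X. ereal (g x y) < k}"
proof -
  assume "y \<in> Y"
  then have c: "continuous_on X (\<lambda>x. ereal (g x y))"
    by (intro continuous_on_ereal continuous_on_g)
  from continuous_open_preimage[OF c open_X open_greaterThan[of k]]
  show "open {x \<in> X. k < ereal (g x y)}" by (simp add: vimage_def Int_def)
  from continuous_open_preimage[OF c open_X open_lessThan[of k]]
  show "open {x \<in> X. ereal (g x y) < k}" by (simp add: vimage_def Int_def)
qed

lemma X_le_borel: "y \<in> Y \<Longrightarrow> X_le X s y k \<in> sets borel"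
proof -
  assume y: "y \<in> Y"
  have "X_le X s y k = X - {x \<in> X. k < ereal (g x y)}" by (auto simp: X_le_def not_le)
  then show ?thesis using open_g_greater[OF y] open_X by auto
qed

section \<open>From nestedness to a common order\<close>

text \<open>Half of the mass of \<open>\<mu>\<close> sits near \<open>x\<close> and half near
  \<open>z\<close>. At \<open>y\<close> the half near \<open>x\<close> is filled first, at
  \<open>y'\<close> the half near \<open>z\<close>. Monotonicity at \<open>k_plus\<close> forces the
  former half into the median sublevel set at \<open>y'\<close> as well, which can only happen if
  \<open>g\<close> is constant there at \<open>y'\<close>.\<close>

lemma nested_imp_no_reversal:
  assumes nest: "\<And>\<mu> \<nu>. ac_prob_on X \<mu> \<Longrightarrow> ac_prob_on Y \<nu> \<Longrightarrow> nested X Y s \<mu> \<nu>"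
    and x: "x \<in> X" and z: "z \<in> X" and y: "y \<in> Y" and y': "y' \<in> Y" and "y < y'"
    and less: "g x y < g z y" and rev: "g z y' < g x y'"
  shows False
proof -
  obtain c c' where c: "g x y < c" "c < g z y" and c': "g z y' < c'" "c' < g x y'"
    using less rev dense by meson
  have N: "open ({u \<in> X. ereal (g u y) < ereal c} \<inter> {u \<in> X. ereal c' < ereal (g u y')})"
      "open ({u \<in> X. ereal c < ereal (g u y)} \<inter> {u \<in> X. ereal (g u y') < ereal c'})"
    by (intro open_Int open_g_less open_g_greater y y')+
  obtain d where d: "d > 0" "ball x d \<subseteq> {u \<in> X. ereal (g u y) < ereal c} \<inter> {u \<in> X. ereal c' < ereal (g u y')}"
    by (rule openE[OF N(1), of x]) (use x c c' in auto)
  obtain d' where d': "d' > 0" "ball z d' \<subseteq> {u \<in> X. ereal c < ereal (g u y)} \<inter> {u \<in> X. ereal (g u y') < ereal c'}"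
    by (rule openE[OF N(2), of z]) (use z c c' in auto)
  define U where "U = ball x d"
  define V where "V = ball z d'"
  have U: "u \<in> X" "g u y < c" "c' < g u y'" if "u \<in> U" for u using d that by (auto simp: U_def)
  have V: "u \<in> X" "c < g u y" "g u y' < c'" if "u \<in> V" for u using d' that by (auto simp: V_def)
  have UV: "open U" "bounded U" "U \<noteq> {}" "U \<subseteq> X" "open V" "bounded V" "V \<noteq> {}" "V \<subseteq> X"
    using d(1) d'(1) U V by (auto simp: U_def V_def)
  have "X \<in> sets borel" "Y \<in> sets borel" using open_X open_Y by auto
  obtain \<mu> where \<mu>: "ac_prob_on X \<mu>" "\<And>A. A \<in> sets borel \<Longrightarrow> A \<subseteq> X \<Longrightarrow> measure \<mu> A =
      (measure lborel (U \<inter> A) / measure lborel U + measure lborel (V \<inter> A) / measure lborel V) / 2"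
    by (rule ac_prob_two_pieces[OF \<open>X \<in> sets borel\<close> UV]) (rule that)
  obtain e where e: "e > 0" "ball y e \<subseteq> Y" using open_Y y openE by blast
  obtain e' where e': "e' > 0" "ball y' e' \<subseteq> Y" using open_Y y' openE by blast
  \<comment> \<open>All mass of \<open>\<nu>\<close> lies to the left of \<open>y\<close> or to the
    right of \<open>y'\<close>, in equal shares, so both points are medians.\<close>
  define U' where "U' = {y - e<..<y}"
  define V' where "V' = {y'<..<y' + e'}"
  have "U' \<subseteq> ball y e" "V' \<subseteq> ball y' e'" by (auto simp: U'_def V'_def dist_real_def)
  then have UV': "open U'" "bounded U'" "U' \<noteq> {}" "U' \<subseteq> Y" "open V'" "bounded V'" "V' \<noteq> {}" "V' \<subseteq> Y"
    using e e' by (auto simp: U'_def V'_def)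
  obtain \<nu> where \<nu>: "ac_prob_on Y \<nu>" "\<And>A. A \<in> sets borel \<Longrightarrow> A \<subseteq> Y \<Longrightarrow> measure \<nu> A =
      (measure lborel (U' \<inter> A) / measure lborel U' + measure lborel (V' \<inter> A) / measure lborel V') / 2"
    by (rule ac_prob_two_pieces[OF \<open>Y \<in> sets borel\<close> UV']) (rule that)
  have half: "measure \<nu> (Y \<inter> {..<t}) = 1/2" if "t = y \<or> t = y'" for t
  proof -
    have "U' \<inter> (Y \<inter> {..<t}) = U'" "V' \<inter> (Y \<inter> {..<t}) = {}"
      using UV'(4) that \<open>y < y'\<close> by (auto simp: U'_def V'_def)
    then show ?thesis
      using \<nu>(2)[of "Y \<inter> {..<t}"] \<open>Y \<in> sets borel\<close> measure_lborel_open_pos[OF UV'(1-3)] by simp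
  qed
  \<comment> \<open>The separating value \<open>c\<close> cuts off exactly the half
    \<open>U\<close>, so it is a level at \<open>y\<close> and bounds \<open>k_plus\<close> from
    below.\<close>
  have "U \<inter> X_le X s y (ereal c) = U" "V \<inter> X_le X s y (ereal c) = {}"
    using U V by (auto simp: X_le_def less_imp_le not_le[symmetric])
  then have "measure \<mu> (X_le X s y (ereal c)) = 1/2"
    using \<mu>(2)[OF X_le_borel[OF y], of "ereal c"] measure_lborel_open_pos[OF UV(1-3)] by (simp add: X_le_def)
  then have "ereal c \<in> levels X Y s \<mu> \<nu> y" using half[of y] by (simp add: levels_def del: eq_divide_eq_numeral1)
  then have "ereal c \<le> k_plus X Y s \<mu> \<nu> y" unfolding k_plus_def by (rule Sup_upper)
  then have "ereal (g u y) \<le> k_plus X Y s \<mu> \<nu> y" if "u \<in> U" for u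
    using order_trans[of "ereal (g u y)" "ereal c"] U(2)[OF that] by simp
  then have "U \<subseteq> X_le X s y (k_plus X Y s \<mu> \<nu> y)"
    using U(1) by (auto simp: X_le_def)
  also have "\<dots> \<subseteq> X_le X s y' (k_plus X Y s \<mu> \<nu> y')"
    using nest[OF \<mu>(1) \<nu>(1)] y y' \<open>y < y'\<close> unfolding nested_def by (auto dest!: mono_onD[of Y _ y y'])
  finally have above: "ereal (g u y') \<le> k_plus X Y s \<mu> \<nu> y'" if "u \<in> U" for u
    using that by (auto simp: X_le_def)
  have below: "k_plus X Y s \<mu> \<nu> y' \<le> ereal (g u y')" if u: "u \<in> U" for u
    unfolding k_plus_def
  proof (rule Sup_least, rule ccontr)
    fix k assume k: "k \<in> levels X Y s \<mu> \<nu> y'" and "\<not> k \<le> ereal (g u y')"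
    then have gk: "ereal (g u y') < k" by simp
    \<comment> \<open>A level above \<open>g u y'\<close> would take in all of \<open>V\<close> and
      in addition this open piece of \<open>U\<close>, hence more than half of the mass.\<close>
    define W where "W = U \<inter> {w \<in> X. ereal (g w y') < k}"
    have W: "open W" "u \<in> W" "bounded W" "W \<subseteq> U \<inter> X_le X s y' k"
      using u U gk UV open_g_less[OF y'] by (auto simp: W_def X_le_def)
    have "V \<inter> X_le X s y' k = V"
    proof -
      have "ereal (g v y') \<le> k" if "v \<in> V" for v
      proof -
        have "ereal (g v y') \<le> ereal (g u y')" using U(3)[OF u] V(3)[OF that] by simp
        also note gk
        finally show ?thesis by simp
      qed
      then show ?thesis using V(1) by (auto simp: X_le_def)
    qed
    moreover have "measure lborel (U \<inter> X_le X s y' k) > 0"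
    proof -
      have "0 < measure lborel W" using W measure_lborel_open_pos by blast
      also have "\<dots> \<le> measure lborel (U \<inter> X_le X s y' k)"
      proof (rule measure_mono_fmeasurable[OF W(4)])
        show "W \<in> sets lborel" using W(1) by simp
        have "emeasure lborel (U \<inter> X_le X s y' k) < \<infinity>"
          by (rule emeasure_lborel_bounded_less_top) (use UV(2) bounded_subset in blast)
        then show "U \<inter> X_le X s y' k \<in> fmeasurable lborel"
          using UV(1) X_le_borel[OF y'] by (intro fmeasurableI) auto
      qed
      finally show ?thesis .
    qed
    ultimately have "measure \<mu> (X_le X s y' k) > 1/2"
      using \<mu>(2)[OF X_le_borel[OF y'], of k] measure_lborel_open_pos[OF UV(1-3)] measure_lborel_open_pos[OF UV(5-7)] by (simp add: X_le_def)
    then show False using k half[of y'] by (simp add: levels_def)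
  qed
  have "x \<in> U" using d by (simp add: U_def)
  from ex_g_greater[OF x y' UV(1) this] obtain w where "w \<in> U" "g x y' < g w y'" by blast
  moreover have "ereal (g x y') = ereal (g w y')"
    using above below \<open>x \<in> U\<close> \<open>w \<in> U\<close> by (metis order_antisym)
  ultimately show False by simp
qed

text \<open>Excluding strict reversals gives only a weak inequality at \<open>y'\<close>. A tie
  there is broken by moving \<open>x\<close> slightly, which would produce a strict
  reversal.\<close>

lemma nested_imp_same_order:
  assumes nest: "\<And>\<mu> \<nu>. ac_prob_on X \<mu> \<Longrightarrow> ac_prob_on Y \<nu> \<Longrightarrow> nested X Y s \<mu> \<nu>"
  shows same_order
proof -
  have no_rev: "g x y' \<le> g z y'" if "x \<in> X" "z \<in> X" "y \<in> Y" "y' \<in> Y" "g x y < g z y" for x z y y'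
  proof (rule ccontr)
    assume "\<not> g x y' \<le> g z y'"
    \<comment> \<open>If \<open>y' < y\<close>, the reversal is read from \<open>y'\<close> to
      \<open>y\<close> with \<open>x\<close> and \<open>z\<close> exchanged.\<close>
    then show False
      using nested_imp_no_reversal[OF nest, of x z y y'] nested_imp_no_reversal[OF nest, of z x y' y] that
      by (cases y y' rule: linorder_cases) (auto simp: not_le)
  qed
  show ?thesis
    unfolding same_order_def
  proof (intro ballI impI, rule ccontr)
    fix x z y y' assume x: "x \<in> X" and z: "z \<in> X" and y: "y \<in> Y" and y': "y' \<in> Y"
      and less: "g x y < g z y" and "\<not> g x y' < g z y'"
    then have eq: "g x y' = g z y'" using no_rev[OF x z y y' less] by simp
    \<comment> \<open>The strict inequality at \<open>y\<close> survives in a neighbourhood of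
      \<open>x\<close>, and some point of it has a larger value at \<open>y'\<close>.\<close>
    have "x \<in> {u \<in> X. ereal (g u y) < ereal (g z y)}" using x less by simp
    from ex_g_greater[OF x y' open_g_less[OF y] this] eq
    obtain u where "u \<in> X" "g u y < g z y" "g z y' < g u y'" by auto
    with no_rev[OF _ z y y', of u] show False by simp
  qed
qed

section \<open>From a common order to nestedness\<close>

lemma X_le_sets:
  assumes "ac_prob_on X \<mu>" "y \<in> Y"
  shows "X_le X s y k \<in> sets \<mu>"
  using assms X_le_borel[OF assms(2)] open_X
  by (auto simp: ac_prob_on_def sets_restrict_space_iff X_le_def)

lemma null_sets_g_level:
  assumes \<mu>: "ac_prob_on X \<mu>" and y: "y \<in> Y"
  shows "{x \<in> X. ereal (g x y) = k} \<in> null_sets \<mu>"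
proof -
  have "{x \<in> X. ereal (g x y) = k} = X_le X s y k - {x \<in> X. ereal (g x y) < k}"
    by (auto simp: X_le_def)
  then have borel: "{x \<in> X. ereal (g x y) = k} \<in> sets borel"
    using sets.Diff[OF X_le_borel[OF y] borel_open[OF open_g_less[OF y]]] by (simp only:)
  have "negligible {x \<in> X. ereal (g x y) = k}"
    using negligible_g_level[OF y] by (cases k) auto
  then have "{x \<in> X. ereal (g x y) = k} \<in> null_sets lborel"
    using borel by (simp add: negligible_iff_null_sets null_sets_completion_iff)
  then have "{x \<in> X. ereal (g x y) = k} \<in> null_sets (restrict_space lborel X)"
    using open_X by (subst null_sets_restrict_space) auto
  then show ?thesis
    using \<mu> unfolding ac_prob_on_def absolutely_continuous_def by blast
qed

text \<open>Off the \<open>\<mu>\<close>-null level set at \<open>k\<close>, the indicators of the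
  sublevel sets are eventually constant along any sequence tending to \<open>k\<close>, infinite
  limits included; dominated convergence does the rest.\<close>

lemma continuous_measure_X_le:
  assumes \<mu>: "ac_prob_on X \<mu>" and y: "y \<in> Y"
  shows "continuous_on UNIV (\<lambda>k. measure \<mu> (X_le X s y k))"
proof (rule continuous_on_sequentiallyI)
  interpret prob_space \<mu> using \<mu> by (simp add: ac_prob_on_def)
  fix u :: "nat \<Rightarrow> ereal" and k assume u: "u \<longlonglongrightarrow> k"
  note meas = X_le_sets[OF \<mu> y]
  have "AE x in \<mu>. x \<notin> {x \<in> X. ereal (g x y) = k}"
    using null_sets_g_level[OF \<mu> y] by (rule AE_not_in)
  then have "AE x in \<mu>. (\<lambda>n. indicator (X_le X s y (u n)) x :: real) \<longlonglongrightarrow> indicator (X_le X s y k) x"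
  proof eventually_elim
    case (elim x)
    show ?case
    proof (cases "x \<in> X")
      case True
      with elim consider "ereal (g x y) < k" | "k < ereal (g x y)" by (auto simp: neq_iff)
      then have "\<forall>\<^sub>F n in sequentially. indicator (X_le X s y (u n)) x = (indicator (X_le X s y k) x :: real)"
      proof cases
        case 1
        from order_tendstoD(1)[OF u 1] show ?thesis
          by eventually_elim (use 1 in \<open>auto simp: X_le_def indicator_def\<close>)
      next
        case 2
        from order_tendstoD(2)[OF u 2] show ?thesis
          by eventually_elim (use 2 in \<open>auto simp: X_le_def indicator_def\<close>)
      qed
      then show ?thesis by (rule tendsto_eventually)
    qed (simp add: X_le_def)
  qed
  then have "(\<lambda>n. \<integral>x. indicator (X_le X s y (u n)) x \<partial>\<mu>) \<longlonglongrightarrow> (\<integral>x. indicator (X_le X s y k) x \<partial>\<mu> :: real)"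
    using meas by (intro integral_dominated_convergence[where w = "\<lambda>x. 1"])
      (auto intro!: AE_I2 simp: indicator_def)
  then show "(\<lambda>n. measure \<mu> (X_le X s y (u n))) \<longlonglongrightarrow> measure \<mu> (X_le X s y k)"
    using sets.sets_into_space[OF meas] by (simp add: Int_absorb2)
qed

text \<open>The mass rises continuously from 0 at minus infinity to 1 at infinity, so levels exist
  by the intermediate value theorem. They form a closed set, which therefore contains its infimum
  and supremum.\<close>

lemma measure_X_le_k:
  assumes \<mu>: "ac_prob_on X \<mu>" and \<nu>: "ac_prob_on Y \<nu>" and y: "y \<in> Y"
  shows measure_X_le_k_minus: "measure \<mu> (X_le X s y (k_minus X Y s \<mu> \<nu> y)) = measure \<nu> (Y \<inter> {..<y})"
    and measure_X_le_k_plus: "measure \<mu> (X_le X s y (k_plus X Y s \<mu> \<nu> y)) = measure \<nu> (Y \<inter> {..<y})"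
proof -
  interpret \<mu>: prob_space \<mu> using \<mu> by (simp add: ac_prob_on_def)
  interpret \<nu>: prob_space \<nu> using \<nu> by (simp add: ac_prob_on_def)
  let ?F = "\<lambda>k. measure \<mu> (X_le X s y k)"
  have cont: "continuous_on UNIV ?F" by (rule continuous_measure_X_le[OF \<mu> y])
  have "space \<mu> = X"
    using sets_eq_imp_space_eq[of \<mu> "restrict_space borel X"] \<mu>
    by (simp add: ac_prob_on_def space_restrict_space)
  then have "?F (-\<infinity>) = 0" "?F \<infinity> = 1"
    using \<mu>.prob_space by (simp_all add: X_le_def)
  then obtain k where "?F k = measure \<nu> (Y \<inter> {..<y})"
    using IVT'[of ?F "-\<infinity>" "measure \<nu> (Y \<inter> {..<y})" \<infinity>] continuous_on_subset[OF cont]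
    by auto
  then have "levels X Y s \<mu> \<nu> y \<noteq> {}" by (auto simp: levels_def)
  moreover have "closed (levels X Y s \<mu> \<nu> y)"
    unfolding levels_def by (intro closed_Collect_eq cont continuous_on_const)
  ultimately have "k_minus X Y s \<mu> \<nu> y \<in> levels X Y s \<mu> \<nu> y" "k_plus X Y s \<mu> \<nu> y \<in> levels X Y s \<mu> \<nu> y"
    unfolding k_minus_def k_plus_def by (simp_all add: closed_contains_Inf_cl closed_contains_Sup_cl)
  then show "?F (k_minus X Y s \<mu> \<nu> y) = measure \<nu> (Y \<inter> {..<y})" "?F (k_plus X Y s \<mu> \<nu> y) = measure \<nu> (Y \<inter> {..<y})"
    by (simp_all add: levels_def)
qed

text \<open>In each of the three cases a point \<open>x\<close> violating the inclusion defines a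
  sublevel set whose mass can be computed at \<open>y\<close> and at \<open>y'\<close> alike.
  Comparison with \<open>N y\<close> and \<open>N y'\<close> gives the contradiction.\<close>

lemma same_order_imp_nested:
  assumes so: same_order and \<mu>: "ac_prob_on X \<mu>" and \<nu>: "ac_prob_on Y \<nu>"
  shows "nested X Y s \<mu> \<nu>"
proof -
  interpret \<mu>: prob_space \<mu> using \<mu> by (simp add: ac_prob_on_def)
  interpret \<nu>: prob_space \<nu> using \<nu> by (simp add: ac_prob_on_def)
  define N where "N y = measure \<nu> (Y \<inter> {..<y})" for y
  let ?m = "k_minus X Y s \<mu> \<nu>" and ?p = "k_plus X Y s \<mu> \<nu>"
  have below: "X_le X s y k \<subseteq> X_le X s y k'" if "k \<le> k'" for y k k'
    using that by (auto simp: X_le_def)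
  have mono: "measure \<mu> (X_le X s y k) \<le> measure \<mu> (X_le X s y k')" if "y \<in> Y" "k \<le> k'" for y k k'
    using that by (intro \<mu>.finite_measure_mono below X_le_sets[OF \<mu>])
  have minus: "measure \<mu> (X_le X s y (?m y)) = N y" and plus: "measure \<mu> (X_le X s y (?p y)) = N y"
    if "y \<in> Y" for y
    using measure_X_le_k[OF \<mu> \<nu> that] by (simp_all add: N_def)
  have minus_le: "?m y \<le> k" and le_plus: "k \<le> ?p y" if "measure \<mu> (X_le X s y k) = N y" for y k
    using that unfolding k_minus_def k_plus_def by (auto simp: levels_def N_def intro: Inf_lower Sup_upper)
  \<comment> \<open>The sublevel set through a given point is one and the same set at all
    parameters; this is the only use of levels across different \<open>y\<close>.\<close>
  have same: "X_le X s y (ereal (g x y)) = X_le X s y' (ereal (g x y'))" if "x \<in> X" "y \<in> Y" "y' \<in> Y" for x y y'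
    using same_orderD[OF so, of x _ y y'] that by (auto simp: X_le_def not_less[symmetric])
  have sets_\<nu>: "B \<in> sets \<nu>" if "B \<in> sets borel" "B \<subseteq> Y" for B
    using \<nu> open_Y that by (auto simp: ac_prob_on_def sets_restrict_space_iff)
  have N_mono: "N y \<le> N y'" if "y \<le> y'" for y y'
    unfolding N_def using that open_Y by (intro \<nu>.finite_measure_mono sets_\<nu>) auto
  show ?thesis
    unfolding nested_def
  proof (intro conjI mono_onI ballI impI subsetI; rule ccontr)
    fix y y' x assume y: "y \<in> Y" "y' \<in> Y" "y \<le> y'" and x: "x \<in> X_le X s y (?m y)" "x \<notin> X_le X s y' (?m y')"
    then have xX: "x \<in> X" and gx: "ereal (g x y) \<le> ?m y" and gx': "?m y' < ereal (g x y')"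
      by (auto simp: X_le_def)
    \<comment> \<open>The point \<open>x\<close> itself may lie exactly on the level
      \<open>?m y\<close>. Moving down to \<open>z\<close> gives a value strictly below
      \<open>?m y\<close> whose mass is squeezed between \<open>N y'\<close> and \<open>N y\<close>,
      hence a level below the infimum.\<close>
    obtain z where z: "z \<in> X" "?m y' < ereal (g z y')" "g z y' < g x y'"
      using ex_g_less[OF xX y(2) open_g_greater[OF y(2), of "?m y'"]] xX gx' by auto
    have "g z y < g x y" using same_orderD[OF so z(1) xX y(2,1)] z(3) by simp
    with gx have less: "ereal (g z y) < ?m y" by (meson less_ereal.simps(1) less_le_trans)
    have "N y' \<le> measure \<mu> (X_le X s y (ereal (g z y)))"
      using mono[OF y(2), of "?m y'" "ereal (g z y')"] z(2) minus[OF y(2)] same[OF z(1) y(1,2)] by simp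
    moreover have "measure \<mu> (X_le X s y (ereal (g z y))) \<le> N y"
      using mono[OF y(1), of "ereal (g z y)" "?m y"] less minus[OF y(1)] by simp
    ultimately have "?m y \<le> ereal (g z y)" using N_mono[OF y(3)] by (intro minus_le) simp
    with less show False by simp
  next
    fix y y' x assume y: "y \<in> Y" "y' \<in> Y" "y \<le> y'" and x: "x \<in> X_le X s y (?p y)" "x \<notin> X_le X s y' (?p y')"
    then have xX: "x \<in> X" and gx: "ereal (g x y) \<le> ?p y" and gx': "?p y' < ereal (g x y')"
      by (auto simp: X_le_def)
    \<comment> \<open>Here \<open>x\<close> itself suffices: its value at \<open>y'\<close> is
      squeezed into being a level above the supremum.\<close>
    have "measure \<mu> (X_le X s y' (ereal (g x y'))) \<le> N y"
      using mono[OF y(1) gx] plus[OF y(1)] same[OF xX y(1,2)] by simp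
    moreover have "N y' \<le> measure \<mu> (X_le X s y' (ereal (g x y')))"
      using mono[OF y(2), of "?p y'" "ereal (g x y')"] gx' plus[OF y(2)] by simp
    ultimately have "ereal (g x y') \<le> ?p y'" using N_mono[OF y(3)] by (intro le_plus) simp
    with gx' show False by simp
  next
    fix y y' x assume y: "y \<in> Y" "y' \<in> Y" "y < y'" and pos: "0 < measure \<nu> {y<..<y'}"
      and x: "x \<in> X_le X s y (?p y)" "x \<notin> X_less X s y' (?m y')"
    then have xX: "x \<in> X" and gx: "ereal (g x y) \<le> ?p y" and gx': "?m y' \<le> ereal (g x y')"
      by (auto simp: X_le_def X_less_def)
    have sub: "{y<..<y'} \<subseteq> Y" using connected_contains_Icc[OF connected_Y y(1,2)] by auto
    \<comment> \<open>The mass of \<open>\<nu>\<close> between \<open>y\<close> and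
      \<open>y'\<close> makes \<open>N\<close> strictly larger at \<open>y'\<close>, while the
      sublevel set through \<open>x\<close> would have mass at least \<open>N y'\<close> and at most
      \<open>N y\<close>.\<close>
    have "N y + measure \<nu> {y<..<y'} = measure \<nu> (Y \<inter> {..<y} \<union> {y<..<y'})"
      unfolding N_def using sub open_Y by (intro \<nu>.finite_measure_Union[symmetric] sets_\<nu>) auto
    also have "\<dots> \<le> N y'"
      unfolding N_def using sub open_Y y(3) by (intro \<nu>.finite_measure_mono sets_\<nu>) auto
    finally have "N y < N y'" using pos by simp
    also have "N y' \<le> measure \<mu> (X_le X s y' (ereal (g x y')))"
      using mono[OF y(2) gx'] minus[OF y(2)] by simp
    also have "\<dots> \<le> N y"
      using mono[OF y(1) gx] plus[OF y(1)] same[OF xX y(1,2)] by simp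
    finally show False by simp
  qed
qed

end

theorem proposition5:
  fixes X :: "(real ^ 'm) set" and Y :: "real set" and a b :: ereal
    and s :: "(real ^ 'm) \<times> real \<Rightarrow> real"
  assumes "open X" and "connected X"
    and "a < b" and "Y = einterval a b"
    and "C2_bounded_on s (X \<times> Y)"
    and "nondegenerate X Y s"
  shows "pseudo_index_form X Y s \<longleftrightarrow>
    (\<forall>\<mu> \<nu>. ac_prob_on X \<mu> \<longrightarrow> ac_prob_on Y \<nu> \<longrightarrow> nested X Y s \<mu> \<nu>)"
proof -
  have "is_interval Y"
    unfolding assms(4) is_interval_1 einterval_def
    by (auto intro: less_le_trans[of _ "ereal _" "ereal _"] le_less_trans[of "ereal _" "ereal _"])
  then interpret nondegenerate_C2 X Y s
    using assms by unfold_locales (auto simp: is_interval_connected)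
  obtain y0 where "y0 \<in> Y"
    using ereal_dense2[OF assms(3)] by (auto simp: assms(4) einterval_def)
  then have "pseudo_index_form X Y s \<longleftrightarrow> same_order"
    using pseudo_index_form_imp_same_order[OF assms(2)] same_order_imp_pseudo_index_form by blast
  also have "\<dots> \<longleftrightarrow> (\<forall>\<mu> \<nu>. ac_prob_on X \<mu> \<longrightarrow> ac_prob_on Y \<nu> \<longrightarrow> nested X Y s \<mu> \<nu>)"
    using same_order_imp_nested nested_imp_same_order by blast
  finally show ?thesis .
qed

end
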